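(* For the quadratic in-context learning problem in $d$ variables, there exists a bilinear Transformer $\mathsf{TF}_{\mathrm{bilin}}$ with embedding dimension $\bar d=2d+1$ implementing block-coordinate descent over a quadratic regression, in the sense that for $\hat y^{(\ell)}:=Z^{(2\ell)}_{\mathsf{TF}_{\mathrm{bilin}}}[\bar d+1,n+1]$ we have $$\hat y^{(\ell)}=\begin{bmatrix}1 & x_{\mathrm{query}}^\top\end{bmatrix}W^{(\ell)}\begin{bmatrix}1 \\ x_{\mathrm{query}}\end{bmatrix},$$ where $W^{(\ell)}=\mathrm{smat}(w^{(\ell)})$ and $w^{(\ell)}\in\mathbb{R}^{\binom{d+2}{2}}$ are iterates of block-coordinate descent started at $w^{(0)}=0$ on the loss $L(w)=\frac1{2n}\sum_{i=1}^n(f(x_i;w)+y_i)^2$, with step sizes $\eta^{(\ell)}$ and feature subsets $b_\ell\subseteq\{1,\dots,\binom{d+2}{2}\}$ that together visit every index ($\bigcup_\ell b_\ell=\{1,\dots,\binom{d+2}{2}\}$), where $b_\ell$ indexes the quadratic monomials contained in the columns of the output of the $\ell$-th bilinear layer.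
   Context: Quadratic in-context learning problem: draw $x_1,\dots,x_{n+1}\overset{i.i.d.}{\sim}\mathcal{N}(0,\mathbf{I}_d)$ and a random quadratic function $f(x)=w_0+\sum_i w_ix[i]+\sum_{1\le i\le j\le d}w_{ij}x[i]x[j]$ with i.i.d. $\mathcal{N}(0,1)$ coefficients; $y_i=f(x_i)$, $x_{\mathrm{query}}=x_{n+1}$. The prompt is $$Z=\begin{bmatrix}1&\cdots&1&1\\ x_1&\cdots&x_n&x_{n+1}\\ \mathbf{0}&\cdots&\mathbf{0}&\mathbf{0}\\ y_1&\cdots&y_n&0\end{bmatrix}\in\mathbb{R}^{(\bar d+1)\times(n+1)},$$ with $\bar d-d-1$ zero rows. Layers: $\mathsf{bilin}(Z)=Z+(\mathrm{diag}(\mathbf{W}_0,0)Z)\odot(\mathrm{diag}(\mathbf{W}_1,0)Z)$ with $\mathbf{W}_0,\mathbf{W}_1\in\mathbb{R}^{\bar d\times\bar d}$ and $\odot$ the entrywise product; $\mathsf{attn}(Z)=Z+\frac1n\mathbf{P}ZM(Z^\top\mathbf{Q}Z)$ with $\mathbf{P},\mathbf{Q}\in\mathbb{R}^{(\bar d+1)\times(\bar d+1)}$ and $M=\mathrm{diag}(\mathbf{I}_n,0)$. A bilinear Transformer with $2L$ layers: $Z^{(0)}=Z$, $Z^{(2\ell+1)}=\mathsf{bilin}(Z^{(2\ell)})$, $Z^{(2\ell+2)}=\mathsf{attn}(Z^{(2\ell+1)})$, $\ell=0,\dots,L-1$, each layer with its own weights. For a symmetric $(d+1)\times(d+1)$ matrix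 $M$, $\mathrm{svec}(M)\in\mathbb{R}^{\binom{d+2}{2}}$ flattens $M$ without repeating the off-diagonal entries, which are scaled by a factor $2$; $\mathrm{smat}$ is the inverse operation. Set $f(x;w)=[1\ x^\top]\,\mathrm{smat}(w)\,[1;x]$, so the coordinates of $w$ are the coefficients of the distinct monomials of degree $\le2$. Block-coordinate descent with subsets $b_\ell$ and step sizes $\eta^{(\ell)}$: $w^{(\ell)}_j=w^{(\ell-1)}_j-\eta^{(\ell)}\,\partial_{w_j}L(w)|_{w=w^{(\ell-1)}}$ if $j\in b_\ell$, and $w^{(\ell)}_j=w^{(\ell-1)}_j$ if $j\notin b_\ell$. *)

theory Defs
  imports
    "HOL-Probability.Distributions"
    "HOL-Library.Nat_Bijection"
    "Jordan_Normal_Form.Matrix"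
begin

no_notation vec_nth (infixl \<open>$\<close> 90)

text \<open>
  Vectors and matrices are those of Jordan_Normal_Form, so all indices start at 0:
  \<open>x[i]\<close> is \<open>x $ (i - 1)\<close>, the columns \<open>1, \<dots>, n + 1\<close> of a prompt are \<open>0, \<dots>, n\<close> (column \<open>n\<close>
  is the query), and its last row, number \<open>D + 1\<close> for the embedding dimension \<open>D\<close>, is \<open>D\<close>.
\<close>


subsection \<open>Symmetric vectorisation and quadratic functions\<close>

abbreviation nfeat :: "nat \<Rightarrow> nat" where
  "nfeat d \<equiv> (d + 2) choose 2"

text \<open>
  Coordinate \<open>k\<close> of a flattened symmetric matrix belongs to the entry \<open>upair k = (i, j)\<close> with
  \<open>i \<le> j\<close>. The upper triangle is enumerated as \<open>(0,0), (0,1), (1,1), (0,2), (1,2), (2,2), \<dots>\<close>,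
  that is \<open>k = triangle j + i\<close>.
\<close>

definition upair :: "nat \<Rightarrow> nat \<times> nat" where
  "upair k = (case prod_decode k of (i, m) \<Rightarrow> (i, i + m))"

definition svec :: "nat \<Rightarrow> real mat \<Rightarrow> real vec" where
  "svec d M = vec (nfeat d) (\<lambda>k. case upair k of (i, j) \<Rightarrow>
     if i = j then M $$ (i, j) else 2 * M $$ (i, j))"

definition smat :: "nat \<Rightarrow> real vec \<Rightarrow> real mat" where
  "smat d w = mat (d + 1) (d + 1) (\<lambda>(i, j).
     if i = j then w $ (triangle j + i) else w $ (triangle (max i j) + min i j) / 2)"

definition quad_fun :: "nat \<Rightarrow> real vec \<Rightarrow> real vec \<Rightarrow> real" where
  "quad_fun d w x = vCons 1 x \<bullet> (smat d w *\<^sub>v vCons 1 x)"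

definition feature :: "nat \<Rightarrow> real vec \<Rightarrow> real" where
  "feature k x = (case upair k of (i, j) \<Rightarrow> vCons 1 x $ i * vCons 1 x $ j)"

lemma upair_triangle: "i \<le> j \<Longrightarrow> upair (triangle j + i) = (i, j)"
proof -
  assume "i \<le> j"
  then have "triangle j + i = prod_encode (i, j - i)"
    by (simp add: prod_encode_def)
  with \<open>i \<le> j\<close> show ?thesis
    by (simp add: upair_def)
qed

lemma triangle_upair:
  assumes "upair k = (i, j)"
  shows "i \<le> j" and "triangle j + i = k"
proof -
  obtain m where m: "prod_decode k = (i, m)" "j = i + m"
    using assms by (auto simp: upair_def split: prod.splits)
  then have "prod_encode (i, m) = k"
    by (metis prod_decode_inverse)
  with m show "i \<le> j" and "triangle j + i = k"
    by (auto simp: prod_encode_def)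
qed

lemma nfeat_triangle: "nfeat d = triangle (d + 1)"
  by (simp add: choose_two triangle_def mult.commute)

lemma triangle_mono: "i \<le> j \<Longrightarrow> triangle i \<le> triangle j"
  unfolding triangle_def by (intro div_le_mono mult_le_mono) auto

lemma triangle_less_nfeat:
  assumes "i \<le> j" "j \<le> d"
  shows "triangle j + i < nfeat d"
proof -
  have "triangle j + i < triangle (Suc j)"
    using assms by simp
  also have "\<dots> \<le> triangle (d + 1)"
    using assms by (intro triangle_mono) simp
  finally show ?thesis
    by (simp only: nfeat_triangle)
qed

lemma upair_le:
  assumes "upair k = (i, j)" "k < nfeat d"
  shows "j \<le> d"
proof (rule ccontr)
  assume "\<not> j \<le> d"
  then have "triangle (d + 1) \<le> triangle j"
    by (intro triangle_mono) simp
  with triangle_upair(2)[OF assms(1)] assms(2) show False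
    by (simp only: nfeat_triangle)
qed

lemma svec_smat:
  assumes "w \<in> carrier_vec (nfeat d)"
  shows "svec d (smat d w) = w"
proof (rule eq_vecI)
  show "dim_vec (svec d (smat d w)) = dim_vec w"
    using assms by (simp add: svec_def)
next
  fix k assume "k < dim_vec w"
  then have k: "k < nfeat d"
    using assms by simp
  obtain i j where ij: "upair k = (i, j)"
    by fastforce
  note * = triangle_upair[OF ij] upair_le[OF ij k]
  show "svec d (smat d w) $ k = w $ k"
    using k * ij by (auto simp: svec_def smat_def)
qed

lemma smat_svec:
  assumes "M \<in> carrier_mat (d + 1) (d + 1)" "transpose_mat M = M"
  shows "smat d (svec d M) = M"
proof (rule eq_matI)
  show "dim_row (smat d (svec d M)) = dim_row M" "dim_col (smat d (svec d M)) = dim_col M"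
    using assms by (simp_all add: smat_def)
next
  fix i j assume "i < dim_row M" "j < dim_col M"
  then have ij: "i \<le> d" "j \<le> d"
    using assms by auto
  have sym: "M $$ (i, j) = M $$ (j, i)"
    using assms ij by (metis carrier_matD index_transpose_mat(1) less_Suc_eq_le Suc_eq_plus1)
  have u: "upair (triangle (max i j) + min i j) = (min i j, max i j)"
    by (rule upair_triangle) simp
  have l: "triangle (max i j) + min i j < nfeat d"
    using ij by (intro triangle_less_nfeat) auto
  show "smat d (svec d M) $$ (i, j) = M $$ (i, j)"
    using ij sym u l by (cases i j rule: linorder_cases) (auto simp: svec_def smat_def max_def min_def)
qed


subsection \<open>The in-context learning problem\<close>

abbreviation std_normal :: "real measure" where
  "std_normal \<equiv> density lborel std_normal_density"

text \<open>
  An outcome \<open>(X, c)\<close> consists of the coordinates \<open>X (k, j)\<close> of the inputs \<open>x\<^sub>1, \<dots>, x\<^sub>n\<^sub>+\<^sub>1\<close> and the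
  coefficients of the random quadratic function: \<open>c (0, 0)\<close> is the constant term, \<open>c (0, i)\<close> the
  coefficient of \<open>x[i]\<close> and \<open>c (i, j)\<close>, for \<open>1 \<le> i \<le> j \<le> d\<close>, that of \<open>x[i] x[j]\<close>.
\<close>

type_synonym outcome = "(nat \<times> nat \<Rightarrow> real) \<times> (nat \<times> nat \<Rightarrow> real)"

definition icl_problem :: "nat \<Rightarrow> nat \<Rightarrow> outcome measure" where
  "icl_problem d n =
     PiM ({..n} \<times> {..<d}) (\<lambda>_. std_normal) \<Otimes>\<^sub>M PiM {(i, j). i \<le> j \<and> j \<le> d} (\<lambda>_. std_normal)"

definition xvec :: "nat \<Rightarrow> outcome \<Rightarrow> nat \<Rightarrow> real vec" where
  "xvec d \<omega> k = vec d (\<lambda>j. fst \<omega> (k, j))"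

definition target :: "nat \<Rightarrow> (nat \<times> nat \<Rightarrow> real) \<Rightarrow> real vec \<Rightarrow> real" where
  "target d c x = c (0, 0) + (\<Sum>i = 1..d. c (0, i) * x $ (i - 1))
     + (\<Sum>i = 1..d. \<Sum>j = i..d. c (i, j) * x $ (i - 1) * x $ (j - 1))"

definition label :: "nat \<Rightarrow> outcome \<Rightarrow> nat \<Rightarrow> real" where
  "label d \<omega> k = target d (snd \<omega>) (xvec d \<omega> k)"

definition prompt :: "nat \<Rightarrow> nat \<Rightarrow> nat \<Rightarrow> outcome \<Rightarrow> real mat" where
  "prompt d D n \<omega> = mat (D + 1) (n + 1) (\<lambda>(r, k).
     if r = 0 then 1
     else if r \<le> d then xvec d \<omega> k $ (r - 1)
     else if r < D then 0
     else if k < n then label d \<omega> k else 0)"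


subsection \<open>Bilinear Transformers\<close>

definition hadamard :: "real mat \<Rightarrow> real mat \<Rightarrow> real mat" where
  "hadamard A B = mat (dim_row A) (dim_col A) (\<lambda>ij. A $$ ij * B $$ ij)"

definition pad_zero :: "real mat \<Rightarrow> real mat" where
  "pad_zero A = four_block_mat A (0\<^sub>m (dim_row A) 1) (0\<^sub>m 1 (dim_col A)) (0\<^sub>m 1 1)"

definition bilin :: "real mat \<Rightarrow> real mat \<Rightarrow> real mat \<Rightarrow> real mat" where
  "bilin W0 W1 Z = Z + hadamard (pad_zero W0 * Z) (pad_zero W1 * Z)"

definition attn :: "nat \<Rightarrow> real mat \<Rightarrow> real mat \<Rightarrow> real mat \<Rightarrow> real mat" where
  "attn n P Q Z =
     Z + (1 / real n) \<cdot>\<^sub>m (P * Z * pad_zero (1\<^sub>m n) * (transpose_mat Z * Q * Z))"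

text \<open>
  \<open>transformer n W0 W1 P Q Z t\<close> is \<open>Z\<^sup>(\<^sup>t\<^sup>)\<close>. The bilinear layer from \<open>Z\<^sup>(\<^sup>2\<^sup>l\<^sup>)\<close> to \<open>Z\<^sup>(\<^sup>2\<^sup>l\<^sup>+\<^sup>1\<^sup>)\<close> has the
  weights \<open>W0 l\<close>, \<open>W1 l\<close>; the attention layer from \<open>Z\<^sup>(\<^sup>2\<^sup>l\<^sup>+\<^sup>1\<^sup>)\<close> to \<open>Z\<^sup>(\<^sup>2\<^sup>l\<^sup>+\<^sup>2\<^sup>)\<close> has \<open>P l\<close>, \<open>Q l\<close>.
\<close>

primrec transformer ::
  "nat \<Rightarrow> (nat \<Rightarrow> real mat) \<Rightarrow> (nat \<Rightarrow> real mat) \<Rightarrow> (nat \<Rightarrow> real mat) \<Rightarrow> (nat \<Rightarrow> real mat) \<Rightarrow>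
   real mat \<Rightarrow> nat \<Rightarrow> real mat" where
  "transformer n W0 W1 P Q Z 0 = Z"
| "transformer n W0 W1 P Q Z (Suc t) =
     (if even t then bilin (W0 (t div 2)) (W1 (t div 2)) (transformer n W0 W1 P Q Z t)
      else attn n (P (t div 2)) (Q (t div 2)) (transformer n W0 W1 P Q Z t))"

text \<open>
  The monomials of degree at most 2 contained in the columns of the \<open>t\<close>-th intermediate output:
  those that some fixed row carries in every column, for every context length and every outcome.
\<close>

definition column_features ::
  "nat \<Rightarrow> nat \<Rightarrow> (nat \<Rightarrow> real mat) \<Rightarrow> (nat \<Rightarrow> real mat) \<Rightarrow> (nat \<Rightarrow> real mat) \<Rightarrow> (nat \<Rightarrow> real mat) \<Rightarrow>
   nat \<Rightarrow> nat set" where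
  "column_features d D W0 W1 P Q t = {j. j < nfeat d \<and>
     (\<exists>r\<le>D. \<forall>n\<ge>1. \<forall>\<omega>\<in>space (icl_problem d n). \<forall>k\<le>n.
        transformer n W0 W1 P Q (prompt d D n \<omega>) t $$ (r, k) = feature j (xvec d \<omega> k))}"


subsection \<open>Block-coordinate descent\<close>

definition loss :: "nat \<Rightarrow> nat \<Rightarrow> outcome \<Rightarrow> real vec \<Rightarrow> real" where
  "loss d n \<omega> w =
     1 / (2 * real n) * (\<Sum>k<n. (quad_fun d w (xvec d \<omega> k) + label d \<omega> k)\<^sup>2)"

definition partial_deriv :: "(real vec \<Rightarrow> real) \<Rightarrow> nat \<Rightarrow> real vec \<Rightarrow> real" where
  "partial_deriv F j w = deriv (\<lambda>t. F (w + t \<cdot>\<^sub>v unit_vec (dim_vec w) j)) 0"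

primrec bcd ::
  "nat \<Rightarrow> (real vec \<Rightarrow> real) \<Rightarrow> (nat \<Rightarrow> real) \<Rightarrow> (nat \<Rightarrow> nat set) \<Rightarrow> nat \<Rightarrow> real vec" where
  "bcd N F eta b 0 = 0\<^sub>v N"
| "bcd N F eta b (Suc l) = vec N (\<lambda>j.
     if j \<in> b (Suc l)
     then bcd N F eta b l $ j - eta (Suc l) * partial_deriv F j (bcd N F eta b l)
     else bcd N F eta b l $ j)"

end

theory Submission
  imports Defs
begin

text \<open>
  The \<open>l\<close>-th of \<open>L = d\<close> rounds keeps the monomials \<open>x\<^sub>l x\<^sub>1, \<dots>, x\<^sub>l x\<^sub>d\<close> in the \<open>d\<close> auxiliary
  rows, so that together with the rows \<open>1, x\<^sub>1, \<dots>, x\<^sub>d\<close> every column carries \<open>2 d + 1\<close> distinct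
  monomials, the block \<open>b\<^sub>l\<close>. If the last row holds the residuals \<open>f(x\<^sub>k; w) + y\<^sub>k\<close> in the context
  columns and \<open>f(x; w)\<close> in the query column, then attention with \<open>Q = - \<eta> I\<close> on the feature rows adds
  \<open>- \<eta>/n \<Sum>\<^sub>i (f(x\<^sub>i; w) + y\<^sub>i) \<Sum>\<^sub>j \<phi>\<^sub>j(x\<^sub>i) \<phi>\<^sub>j(x\<^sub>k)\<close> to it, where \<open>j\<close> ranges over the block: this is the
  effect on the predictions of one gradient step in the block coordinates.
\<close>

text \<open>With \<open>add_2_eq_Suc'\<close> the simplifier would rewrite \<open>d + 2\<close> inside \<open>nfeat d\<close>, after which facts about
  \<open>nfeat d\<close> no longer match.\<close>

declare add_2_eq_Suc' [simp del] bcd.simps(2) [simp del]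

section \<open>Quadratic features\<close>

text \<open>Using \<open>max\<close> and \<open>min\<close> makes the index symmetric, so the two
  factors of a monomial may come in either order. Index 0 stands for the constant coordinate
  1.\<close>

definition pair_index :: "nat \<Rightarrow> nat \<Rightarrow> nat" where
  "pair_index i j = triangle (max i j) + min i j"

lemma upair_pair_index: "upair (pair_index i j) = (min i j, max i j)"
  unfolding pair_index_def by (rule upair_triangle) simp

lemma pair_index_less_nfeat: "i \<le> d \<Longrightarrow> j \<le> d \<Longrightarrow> pair_index i j < nfeat d"
  unfolding pair_index_def by (rule triangle_less_nfeat) auto

lemma pair_index_eq_iff:
  "pair_index i j = pair_index i' j' \<longleftrightarrow> (min i j = min i' j' \<and> max i j = max i' j')"
  by (metis upair_pair_index pair_index_def prod.inject)

lemma nfeat_cases: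
  assumes "k < nfeat d"
  obtains i j where "i \<le> j" "j \<le> d" "k = pair_index i j"
proof -
  obtain i j where ij: "upair k = (i, j)"
    by fastforce
  then show thesis
    using that[of i j] triangle_upair[OF ij] upair_le[OF ij assms]
    by (simp add: pair_index_def max_def min_def)
qed

lemma feature_pair_index:
  "feature (pair_index i j) x = vCons 1 x $ i * vCons 1 x $ j"
  by (auto simp: feature_def upair_pair_index min_def max_def)

text \<open>Induction on the size. The upper triangle is enumerated column by column, so a larger
  size only appends column \<open>m\<close>; row \<open>m\<close> mirrors it by symmetry, and the
  two half coefficients add up to a whole one.\<close>

lemma symmetric_square_sum:
  fixes w :: "nat \<Rightarrow> real" and v :: "nat \<Rightarrow> real"
  shows "(\<Sum>i<m. \<Sum>j<m.
      v i * ((if i = j then w (pair_index i j) else w (pair_index i j) / 2) * v j)) =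
    (\<Sum>k<triangle m. w k * (case upair k of (i, j) \<Rightarrow> v i * v j))"
proof (induction m)
  case 0
  then show ?case by simp
next
  case (Suc m)
  define g where "g i j = v i * ((if i = j then w (pair_index i j) else w (pair_index i j) / 2) * v j)" for i j
  have comm: "g m i = g i m" for i
    by (simp add: g_def pair_index_def max.commute min.commute)
  have "(\<Sum>j<m. g m j) = (\<Sum>i<m. g i m)"
    by (intro sum.cong refl comm)
  then have "(\<Sum>i<Suc m. \<Sum>j<Suc m. g i j) =
      (\<Sum>i<m. \<Sum>j<m. g i j) + ((\<Sum>i<m. 2 * g i m) + g m m)"
    unfolding sum_distrib_left[symmetric] by (simp add: sum.distrib)
  moreover have "(\<Sum>i<m. 2 * g i m) + g m m =
      (\<Sum>i<Suc m. w (triangle m + i) * (v i * v m))"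
    by (simp add: g_def pair_index_def max_def min_def mult_ac)
  moreover have "(\<Sum>k<triangle (Suc m). w k * (case upair k of (i, j) \<Rightarrow> v i * v j)) =
      (\<Sum>k<triangle m. w k * (case upair k of (i, j) \<Rightarrow> v i * v j)) +
      (\<Sum>i<Suc m. w (triangle m + i) * (v i * v m))"
  proof -
    have split: "{..<triangle (Suc m)} = {..<triangle m} \<union> (\<lambda>i. triangle m + i) ` {..<Suc m}"
    proof -
      have "x \<in> (\<lambda>i. triangle m + i) ` {..<Suc m}" if "\<not> x < triangle m" "x < triangle m + Suc m" for x
        using that by (intro image_eqI[of _ _ "x - triangle m"]) auto
      then show ?thesis by fastforce
    qed
    have "(\<Sum>k\<in>(\<lambda>i. triangle m + i) ` {..<Suc m}. w k * (case upair k of (i, j) \<Rightarrow> v i * v j)) =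
        (\<Sum>i<Suc m. w (triangle m + i) * (v i * v m))"
      by (subst sum.reindex) (auto simp: upair_triangle intro!: sum.cong)
    then show ?thesis
      unfolding split by (subst sum.union_disjoint) auto
  qed
  ultimately show ?case
    using Suc.IH unfolding g_def by linarith
qed

text \<open>Predictions are linear in the coefficients, with the monomials as features; all gradient
  computations rest on this form.\<close>

lemma quad_fun_eq_sum:
  assumes "x \<in> carrier_vec d"
  shows "quad_fun d w x = (\<Sum>k<nfeat d. w $ k * feature k x)"
proof -
  have "quad_fun d w x = (\<Sum>i<d + 1. \<Sum>j<d + 1. vCons 1 x $ i *
      ((if i = j then w $ pair_index i j else w $ pair_index i j / 2) * vCons 1 x $ j))"
    using assms
    by (auto simp: quad_fun_def smat_def scalar_prod_def sum_distrib_left pair_index_def atLeast0LessThan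
        simp del: sum.lessThan_Suc intro!: sum.cong)
  also have "\<dots> = (\<Sum>k<nfeat d. w $ k * feature k x)"
    unfolding symmetric_square_sum[where w = "\<lambda>k. w $ k" and v = "\<lambda>i. vCons 1 x $ i"]
      nfeat_triangle feature_def ..
  finally show ?thesis .
qed

text \<open>Test points separate monomials: doubling coordinate \<open>p\<close> of the all-ones
  vector multiplies a monomial by 2 to the power of the multiplicity of \<open>p\<close> in
  it.\<close>

lemma feature_eq_imp_eq:
  assumes "k < nfeat d" "k' < nfeat d"
    and eq: "\<And>x. x \<in> carrier_vec d \<Longrightarrow> feature k x = feature k' x"
  shows "k = k'"
proof -
  obtain i j where k: "i \<le> j" "j \<le> d" "k = pair_index i j"
    using assms(1) by (rule nfeat_cases)
  obtain i' j' where k': "i' \<le> j'" "j' \<le> d" "k' = pair_index i' j'"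
    using assms(2) by (rule nfeat_cases)
  \<comment> \<open>\<open>a p q\<close> is coordinate \<open>q\<close> of the test point for
    \<open>p\<close>, extended by the constant. The condition \<open>q \<noteq> 0\<close> keeps the
    constant coordinate equal to 1.\<close>
  define a :: "nat \<Rightarrow> nat \<Rightarrow> real" where "a p q = (if p = q \<and> q \<noteq> 0 then 2 else 1)" for p q
  have *: "a p i * a p j = a p i' * a p j'" for p
  proof -
    let ?x = "vec d (\<lambda>q. a p (q + 1))"
    have "vCons 1 ?x $ q = a p q" if "q \<le> d" for q
      using that by (cases q) (auto simp: a_def)
    then show ?thesis
      using eq[of ?x] k k' by (simp add: feature_pair_index)
  qed
  \<comment> \<open>The test point for the larger of \<open>j\<close> and \<open>j'\<close> leaves
    the other monomial at 1, since both its indices are smaller.\<close>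
  have "\<not> j < j'" "\<not> j' < j"
    using *[of j'] *[of j] k(1) k'(1) by (auto simp: a_def split: if_splits)
  then have j: "j = j'"
    by simp
  have i: "a p i = a p i'" for p
  proof -
    have "a p j \<noteq> 0"
      by (simp add: a_def)
    then show ?thesis
      using *[of p] j by simp
  qed
  have "i = i'"
    using i[of i] i[of i'] by (auto simp: a_def split: if_splits)
  with j show ?thesis
    using k k' by simp
qed

section \<open>Gradient of the loss\<close>

lemma xvec_carrier [simp]: "xvec d \<omega> k \<in> carrier_vec d" "dim_vec (xvec d \<omega> k) = d"
  by (simp_all add: xvec_def)

lemma quad_fun_add_unit:
  assumes "w \<in> carrier_vec (nfeat d)" "x \<in> carrier_vec d" "j < nfeat d"
  shows "quad_fun d (w + t \<cdot>\<^sub>v unit_vec (nfeat d) j) x = quad_fun d w x + t * feature j x"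
proof -
  have "(\<Sum>k<nfeat d. (w + t \<cdot>\<^sub>v unit_vec (nfeat d) j) $ k * feature k x) =
      (\<Sum>k<nfeat d. w $ k * feature k x + (if k = j then t * feature j x else 0))"
    using assms by (intro sum.cong) (auto simp: unit_vec_def algebra_simps)
  then show ?thesis
    using assms by (simp add: quad_fun_eq_sum sum.distrib)
qed

text \<open>Along coordinate \<open>j\<close> each residual is affine in \<open>t\<close> with slope
  the feature, and the factor 2 from the square cancels the one in the denominator.\<close>

lemma partial_deriv_loss:
  assumes "w \<in> carrier_vec (nfeat d)" "j < nfeat d"
  shows "partial_deriv (loss d n \<omega>) j w =
    1 / real n * (\<Sum>k<n. (quad_fun d w (xvec d \<omega> k) + label d \<omega> k) * feature j (xvec d \<omega> k))"
proof -
  define u where "u k = quad_fun d w (xvec d \<omega> k) + label d \<omega> k" for k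
  define p where "p k = feature j (xvec d \<omega> k)" for k
  have "loss d n \<omega> (w + t \<cdot>\<^sub>v unit_vec (dim_vec w) j) =
      1 / (2 * real n) * (\<Sum>k<n. (u k + t * p k)\<^sup>2)" for t
    using assms by (simp add: loss_def quad_fun_add_unit u_def p_def algebra_simps)
  moreover have "((\<lambda>t. 1 / (2 * real n) * (\<Sum>k<n. (u k + t * p k)\<^sup>2)) has_field_derivative
      1 / real n * (\<Sum>k<n. u k * p k)) (at 0)"
    by (auto intro!: derivative_eq_intros simp: sum_distrib_left mult_ac)
  ultimately show ?thesis
    unfolding partial_deriv_def u_def p_def by (simp add: DERIV_imp_deriv)
qed

lemma bcd_carrier: "bcd N F eta b l \<in> carrier_vec N"
  by (cases l) (auto simp: bcd.simps(2))

text \<open>The Transformer stores predictions rather than coefficients, so the descent step is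
  rewritten in predictions alone: the block enters only through the kernel that sums products of its
  features.\<close>

lemma quad_fun_bcd_Suc:
  assumes "b (Suc l) \<subseteq> {..<nfeat d}" "x \<in> carrier_vec d"
  shows "quad_fun d (bcd (nfeat d) (loss d n \<omega>) eta b (Suc l)) x =
    quad_fun d (bcd (nfeat d) (loss d n \<omega>) eta b l) x - eta (Suc l) / real n *
      (\<Sum>i<n. (quad_fun d (bcd (nfeat d) (loss d n \<omega>) eta b l) (xvec d \<omega> i) + label d \<omega> i) *
        (\<Sum>j\<in>b (Suc l). feature j (xvec d \<omega> i) * feature j x))"
proof -
  define w where "w = bcd (nfeat d) (loss d n \<omega>) eta b l"
  define u where "u i = quad_fun d w (xvec d \<omega> i) + label d \<omega> i" for i
  have w: "w \<in> carrier_vec (nfeat d)"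
    by (simp add: w_def bcd_carrier)
  have "quad_fun d (bcd (nfeat d) (loss d n \<omega>) eta b (Suc l)) x =
      (\<Sum>k<nfeat d. w $ k * feature k x -
        (if k \<in> b (Suc l) then eta (Suc l) * partial_deriv (loss d n \<omega>) k w * feature k x else 0))"
    using assms(2) by (auto simp: bcd.simps(2) quad_fun_eq_sum w_def algebra_simps intro!: sum.cong)
  also have "\<dots> = quad_fun d w x -
      (\<Sum>k\<in>b (Suc l). eta (Suc l) * partial_deriv (loss d n \<omega>) k w * feature k x)"
    using assms by (simp add: quad_fun_eq_sum sum_subtractf sum.inter_restrict[symmetric] Int_absorb1)
  also have "(\<Sum>k\<in>b (Suc l). eta (Suc l) * partial_deriv (loss d n \<omega>) k w * feature k x) =
      (\<Sum>k\<in>b (Suc l). \<Sum>i<n. eta (Suc l) / real n * (u i * (feature k (xvec d \<omega> i) * feature k x)))"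
    using assms(1) w
    by (intro sum.cong)
      (auto simp: partial_deriv_loss u_def sum_distrib_left sum_distrib_right mult_ac)
  also have "\<dots> = eta (Suc l) / real n * (\<Sum>i<n. u i * (\<Sum>j\<in>b (Suc l). feature j (xvec d \<omega> i) * feature j x))"
    by (subst sum.swap) (simp add: sum_distrib_left)
  finally show ?thesis
    by (simp add: w_def u_def)
qed

text \<open>Zero predictions and zero labels give zero residuals, so descent never leaves the zero
  function. \<open>x\<close> is arbitrary in the induction because a step at \<open>x\<close> uses
  the predictions at the context inputs.\<close>

lemma quad_fun_bcd_zero_labels:
  assumes "\<And>i. i < n \<Longrightarrow> label d \<omega> i = 0" "\<And>l. b (Suc l) \<subseteq> {..<nfeat d}" "x \<in> carrier_vec d"
  shows "quad_fun d (bcd (nfeat d) (loss d n \<omega>) eta b l) x = 0"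
  using assms(3)
proof (induction l arbitrary: x)
  case 0
  then show ?case by (simp add: quad_fun_eq_sum)
next
  case (Suc l)
  then show ?case
    using assms(1,2) by (simp add: quad_fun_bcd_Suc)
qed

section \<open>The Transformer\<close>

definition row_feature :: "nat \<Rightarrow> nat \<Rightarrow> nat \<Rightarrow> nat" where
  "row_feature d l r = (if r \<le> d then pair_index 0 r else pair_index l (r - d))"

text \<open>In round \<open>l\<close> auxiliary row \<open>d + j\<close> holds the product of
  coordinates \<open>l\<close> and \<open>j\<close>. The empty value outside the rounds keeps every
  block within the feature range, whatever \<open>l\<close> is.\<close>

definition block :: "nat \<Rightarrow> nat \<Rightarrow> nat set" where
  "block d l = (if l \<in> {1..d} then row_feature d l ` {..2 * d} else {})"

lemma row_feature_less: "l \<le> d \<Longrightarrow> r \<le> 2 * d \<Longrightarrow> row_feature d l r < nfeat d"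
  by (auto simp: row_feature_def intro!: pair_index_less_nfeat)

lemma block_subset: "block d l \<subseteq> {..<nfeat d}"
  by (auto simp: block_def row_feature_less)

text \<open>Auxiliary monomials have both indices at least 1, whereas those of the rows up to
  \<open>d\<close> contain the index 0. Hence a sum over rows counts no monomial twice.\<close>

lemma inj_on_row_feature: "l \<ge> 1 \<Longrightarrow> inj_on (row_feature d l) {..2 * d}"
  by (rule inj_onI) (auto simp: row_feature_def pair_index_eq_iff min_def max_def split: if_splits)

text \<open>Monomials of degree at most 1 lie already in block 1, which is a genuine round as
  \<open>d \<ge> 1\<close>; the product of coordinates \<open>i \<le> j\<close> with
  \<open>i \<ge> 1\<close> lies in block \<open>i\<close>.\<close>

lemma Union_block:
  assumes "d \<ge> 1"
  shows "(\<Union>l\<in>{1..d}. block d l) = {..<nfeat d}"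
proof (intro equalityI subsetI)
  fix k assume "k \<in> {..<nfeat d}"
  then have "k < nfeat d" by simp
  then obtain i j where k: "i \<le> j" "j \<le> d" "k = pair_index i j"
    by (rule nfeat_cases)
  show "k \<in> (\<Union>l\<in>{1..d}. block d l)"
  proof (cases "i = 0")
    case True
    then have "k = row_feature d 1 j"
      using k by (simp add: row_feature_def)
    then show ?thesis
      using assms k by (auto simp: block_def intro!: bexI[of _ "Suc 0"])
  next
    case False
    then have "k = row_feature d i (d + j)"
      using k by (simp add: row_feature_def)
    then show ?thesis
      using k False by (auto simp: block_def intro!: bexI[of _ i])
  qed
qed (use block_subset in blast)

text \<open>Weights are numbered from 0, so layer \<open>l\<close> moves the auxiliary rows from
  round \<open>l\<close> to round \<open>l + 1\<close>. At \<open>l = 0\<close> these rows are still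
  zero and column 0 would select the constant, so nothing is subtracted.\<close>

definition bilin_left :: "nat \<Rightarrow> nat \<Rightarrow> real mat" where
  "bilin_left d l = mat (2 * d + 1) (2 * d + 1) (\<lambda>(r, c).
     if r \<le> d then 0 else if c = l + 1 then 1 else if c = l \<and> l > 0 then -1 else 0)"

definition bilin_right :: "nat \<Rightarrow> real mat" where
  "bilin_right d = mat (2 * d + 1) (2 * d + 1) (\<lambda>(r, c). if d < r \<and> c = r - d then 1 else 0)"

definition attn_value :: "nat \<Rightarrow> real mat" where
  "attn_value d = mat (2 * d + 2) (2 * d + 2) (\<lambda>(r, c). if r = 2 * d + 1 \<and> c = r then 1 else 0)"

definition attn_key_query :: "nat \<Rightarrow> real \<Rightarrow> real mat" where
  "attn_key_query d \<eta> = mat (2 * d + 2) (2 * d + 2) (\<lambda>(r, c). if r = c \<and> r \<le> 2 * d then - \<eta> else 0)"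

text \<open>The invariant of the computation. Round and coefficients are separate arguments because
  a bilinear layer replaces the monomials before attention updates the predictions.\<close>

definition state :: "nat \<Rightarrow> nat \<Rightarrow> outcome \<Rightarrow> nat \<Rightarrow> real vec \<Rightarrow> real mat" where
  "state d n \<omega> l w = mat (2 * d + 2) (n + 1) (\<lambda>(r, k).
     if r \<le> d then vCons 1 (xvec d \<omega> k) $ r
     else if r \<le> 2 * d then
       (if l = 0 then 0 else vCons 1 (xvec d \<omega> k) $ l * vCons 1 (xvec d \<omega> k) $ (r - d))
     else (if k < n then label d \<omega> k else 0) + quad_fun d w (xvec d \<omega> k))"

lemma state_feature:
  assumes "1 \<le> l" "r \<le> 2 * d" "k \<le> n"
  shows "state d n \<omega> l w $$ (r, k) = feature (row_feature d l r) (xvec d \<omega> k)"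
  using assms by (auto simp: state_def row_feature_def feature_pair_index)

lemma state_last:
  assumes "k \<le> n"
  shows "state d n \<omega> l w $$ (Suc (2 * d), k) =
    (if k < n then label d \<omega> k else 0) + quad_fun d w (xvec d \<omega> k)"
  using assms by (simp add: state_def)

section \<open>The bilinear layer\<close>

lemma pad_zero_mult_index:
  assumes "A \<in> carrier_mat m m" "Z \<in> carrier_mat (m + 1) q" "r \<le> m" "k < q"
  shows "(pad_zero A * Z) $$ (r, k) = (if r < m then \<Sum>c<m. A $$ (r, c) * Z $$ (c, k) else 0)"
  using assms
  by (auto simp: pad_zero_def scalar_prod_def atLeast0LessThan intro!: sum.neutral)

lemma bilin_index:
  assumes "A \<in> carrier_mat m m" "B \<in> carrier_mat m m" "Z \<in> carrier_mat (m + 1) q" "r \<le> m" "k < q"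
  shows "bilin A B Z $$ (r, k) = Z $$ (r, k) + (if r < m then
    (\<Sum>c<m. A $$ (r, c) * Z $$ (c, k)) * (\<Sum>c<m. B $$ (r, c) * Z $$ (c, k)) else 0)"
proof -
  have "dim_row (pad_zero A) = m + 1" "dim_row (pad_zero B) = m + 1"
    using assms by (auto simp: pad_zero_def)
  then show ?thesis
    using assms pad_zero_mult_index[OF assms(1,3,4,5)] pad_zero_mult_index[OF assms(2,3,4,5)]
    by (auto simp: bilin_def hadamard_def simp del: index_mult_mat(1))
qed

lemma bilin_dims:
  assumes "A \<in> carrier_mat m m" "Z \<in> carrier_mat (m + 1) q"
  shows "dim_row (bilin A B Z) = m + 1" "dim_col (bilin A B Z) = q"
  using assms by (auto simp: bilin_def hadamard_def pad_zero_def)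

text \<open>The row holding \<open>x\<^sub>l x\<^sub>j\<close> receives \<open>(x\<^sub>l\<^sub>+\<^sub>1 - x\<^sub>l) x\<^sub>j\<close>: one product both erases the
  old monomial and writes the new one, so \<open>d\<close> auxiliary rows suffice.\<close>

lemma bilin_state:
  assumes "l < d"
  shows "bilin (bilin_left d l) (bilin_right d) (state d n \<omega> l w) = state d n \<omega> (Suc l) w"
proof (rule eq_matI)
  have c: "bilin_left d l \<in> carrier_mat (2 * d + 1) (2 * d + 1)"
    "bilin_right d \<in> carrier_mat (2 * d + 1) (2 * d + 1)"
    "state d n \<omega> l w \<in> carrier_mat (2 * d + 1 + 1) (n + 1)"
    by (auto simp: bilin_left_def bilin_right_def state_def)
  show "dim_row (bilin (bilin_left d l) (bilin_right d) (state d n \<omega> l w)) = dim_row (state d n \<omega> (Suc l) w)"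
    "dim_col (bilin (bilin_left d l) (bilin_right d) (state d n \<omega> l w)) = dim_col (state d n \<omega> (Suc l) w)"
    unfolding bilin_dims[OF c(1,3)] by (simp_all add: state_def)
  fix r k assume "r < dim_row (state d n \<omega> (Suc l) w)" "k < dim_col (state d n \<omega> (Suc l) w)"
  then have r: "r \<le> 2 * d + 1" and k: "k < n + 1"
    by (auto simp: state_def)
  define z where "z = (\<lambda>c. state d n \<omega> l w $$ (c, k))"
  have z: "z c = vCons 1 (xvec d \<omega> k) $ c" if "c \<le> d" for c
    using that k by (simp add: z_def state_def)
  have L: "(\<Sum>c<2 * d + 1. bilin_left d l $$ (r, c) * z c) =
      (if r \<le> d then 0 else z (Suc l) - (if l = 0 then 0 else z l))" if "r \<le> 2 * d"
  proof -
    have "(\<Sum>c<2 * d + 1. bilin_left d l $$ (r, c) * z c) =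
        (\<Sum>c<2 * d + 1. (if c = Suc l then (if r \<le> d then 0 else z (Suc l)) else 0)
          - (if c = l then (if r \<le> d \<or> l = 0 then 0 else z l) else 0))"
      using that by (intro sum.cong) (auto simp: bilin_left_def)
    then show ?thesis
      using assms by (simp add: sum_subtractf)
  qed
  have R: "(\<Sum>c<2 * d + 1. bilin_right d $$ (r, c) * z c) = (if r \<le> d then 0 else z (r - d))"
    if "r \<le> 2 * d"
  proof -
    have "(\<Sum>c<2 * d + 1. bilin_right d $$ (r, c) * z c) =
        (\<Sum>c<2 * d + 1. if c = r - d then (if r \<le> d then 0 else z (r - d)) else 0)"
      using that by (intro sum.cong) (auto simp: bilin_right_def)
    moreover have "r - d < 2 * d + 1"
      using that by simp
    ultimately show ?thesis
      by simp
  qed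
  have "bilin (bilin_left d l) (bilin_right d) (state d n \<omega> l w) $$ (r, k) = z r +
      (if r < 2 * d + 1 then (\<Sum>c<2 * d + 1. bilin_left d l $$ (r, c) * z c) *
        (\<Sum>c<2 * d + 1. bilin_right d $$ (r, c) * z c) else 0)"
    unfolding z_def by (rule bilin_index[OF c r k])
  also have "\<dots> = z r + (if d < r \<and> r \<le> 2 * d then
      (z (Suc l) - (if l = 0 then 0 else z l)) * z (r - d) else 0)"
    using L R by auto
  also have "\<dots> = state d n \<omega> (Suc l) w $$ (r, k)"
  proof (cases "d < r \<and> r \<le> 2 * d")
    case True
    then have "r - d \<le> d"
      by arith
    have "z r = (if l = 0 then 0 else vCons 1 (xvec d \<omega> k) $ l * vCons 1 (xvec d \<omega> k) $ (r - d))"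
      using True k by (simp add: z_def state_def)
    then have "z r = (if l = 0 then 0 else z l * z (r - d))"
      using assms z[of l] z[OF \<open>r - d \<le> d\<close>] by simp
    moreover have "state d n \<omega> (Suc l) w $$ (r, k) = z (Suc l) * z (r - d)"
      using assms k True z[of "Suc l"] z[OF \<open>r - d \<le> d\<close>] by (simp add: state_def)
    ultimately show ?thesis
      using True by (simp add: algebra_simps)
  next
    case False
    then show ?thesis
      using r k by (auto simp: z_def state_def)
  qed
  finally show "bilin (bilin_left d l) (bilin_right d) (state d n \<omega> l w) $$ (r, k) =
    state d n \<omega> (Suc l) w $$ (r, k)" .
qed

section \<open>The attention layer as a gradient step\<close>

lemma mult_mat_index:
  assumes "A \<in> carrier_mat m p" "B \<in> carrier_mat p q" "r < m" "k < q"
  shows "(A * B) $$ (r, k) = (\<Sum>c<p. A $$ (r, c) * B $$ (c, k))"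
  using assms by (auto simp: scalar_prod_def atLeast0LessThan)

lemma mult_pad_zero_one_index:
  assumes "A \<in> carrier_mat m (n + 1)" "r < m" "k \<le> n"
  shows "(A * pad_zero (1\<^sub>m n)) $$ (r, k) = (if k < n then A $$ (r, k) else 0)"
proof -
  have "pad_zero (1\<^sub>m n) \<in> carrier_mat (n + 1) (n + 1)"
    by (auto simp: pad_zero_def)
  then have "(A * pad_zero (1\<^sub>m n)) $$ (r, k) =
      (\<Sum>c<n + 1. A $$ (r, c) * pad_zero (1\<^sub>m n) $$ (c, k))"
    using assms by (intro mult_mat_index) auto
  also have "\<dots> = (\<Sum>c<n + 1. if c = k then (if k < n then A $$ (r, k) else 0) else 0)"
    using assms by (intro sum.cong) (auto simp: pad_zero_def)
  finally show ?thesis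
    using assms by simp
qed

text \<open>The mask annihilates the query column of \<open>P * Z\<close>, so only context columns
  are summed, while the update still reaches every column.\<close>

lemma attn_index:
  assumes "P \<in> carrier_mat m m" "Q \<in> carrier_mat m m" "Z \<in> carrier_mat m (n + 1)" "r < m" "k \<le> n"
  shows "attn n P Q Z $$ (r, k) = Z $$ (r, k) +
    1 / real n * (\<Sum>i<n. (P * Z) $$ (r, i) * (transpose_mat Z * Q * Z) $$ (i, k))"
proof -
  define B where "B = transpose_mat Z * Q * Z"
  define A where "A = P * Z * pad_zero (1\<^sub>m n)"
  have B: "B \<in> carrier_mat (n + 1) (n + 1)"
    using assms by (auto simp: B_def)
  have A: "A \<in> carrier_mat m (n + 1)"
    using assms by (auto simp: A_def pad_zero_def)
  have PZ: "P * Z \<in> carrier_mat m (n + 1)"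
    using assms by auto
  have "(A * B) $$ (r, k) = (\<Sum>i<n + 1. A $$ (r, i) * B $$ (i, k))"
    using A B assms(4,5) by (intro mult_mat_index) auto
  also have "\<dots> = (\<Sum>i<n. (P * Z) $$ (r, i) * B $$ (i, k))"
    using mult_pad_zero_one_index[OF PZ assms(4)] by (simp add: A_def)
  finally have "(A * B) $$ (r, k) = (\<Sum>i<n. (P * Z) $$ (r, i) * B $$ (i, k))" .
  moreover have "attn n P Q Z $$ (r, k) = Z $$ (r, k) + 1 / real n * (A * B) $$ (r, k)"
    using A B assms(3-5) unfolding attn_def A_def[symmetric] B_def[symmetric]
    by (simp del: index_mult_mat(1))
  ultimately show ?thesis
    by (simp add: B_def)
qed

lemma attn_dims:
  assumes "P \<in> carrier_mat m m" "Z \<in> carrier_mat m (n + 1)"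
  shows "dim_row (attn n P Q Z) = m" "dim_col (attn n P Q Z) = n + 1"
  using assms by (auto simp: attn_def)

lemma attn_value_mult_index:
  assumes "Z \<in> carrier_mat (2 * d + 2) q" "r < 2 * d + 2" "k < q"
  shows "(attn_value d * Z) $$ (r, k) = (if r = 2 * d + 1 then Z $$ (r, k) else 0)"
proof -
  have "(attn_value d * Z) $$ (r, k) = (\<Sum>c<2 * d + 2. attn_value d $$ (r, c) * Z $$ (c, k))"
    using assms by (intro mult_mat_index) (auto simp: attn_value_def)
  also have "\<dots> = (\<Sum>c<2 * d + 2. if c = r then (if r = 2 * d + 1 then Z $$ (r, k) else 0) else 0)"
    using assms by (intro sum.cong) (auto simp: attn_value_def)
  finally show ?thesis
    using assms by simp
qed

lemma attn_key_query_form: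
  assumes "Z \<in> carrier_mat (2 * d + 2) q" "i < q" "k < q"
  shows "(transpose_mat Z * attn_key_query d \<eta> * Z) $$ (i, k) =
    - \<eta> * (\<Sum>a\<le>2 * d. Z $$ (a, i) * Z $$ (a, k))"
proof -
  have c: "attn_key_query d \<eta> \<in> carrier_mat (2 * d + 2) (2 * d + 2)"
    by (simp add: attn_key_query_def)
  have 1: "(transpose_mat Z * attn_key_query d \<eta>) $$ (i, a) =
      (if a \<le> 2 * d then - \<eta> * Z $$ (a, i) else 0)" if "a < 2 * d + 2" for a
  proof -
    have "(transpose_mat Z * attn_key_query d \<eta>) $$ (i, a) =
        (\<Sum>c<2 * d + 2. transpose_mat Z $$ (i, c) * attn_key_query d \<eta> $$ (c, a))"
      using assms that c by (intro mult_mat_index) auto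
    also have "\<dots> = (\<Sum>c<2 * d + 2. if c = a then (if a \<le> 2 * d then - \<eta> * Z $$ (a, i) else 0) else 0)"
      using assms that by (intro sum.cong) (auto simp: attn_key_query_def)
    finally show ?thesis
      using that by simp
  qed
  have "(transpose_mat Z * attn_key_query d \<eta> * Z) $$ (i, k) =
      (\<Sum>a<2 * d + 2. (transpose_mat Z * attn_key_query d \<eta>) $$ (i, a) * Z $$ (a, k))"
    using assms c by (intro mult_mat_index) auto
  also have "\<dots> = (\<Sum>a<2 * d + 2. (if a \<le> 2 * d then - \<eta> * Z $$ (a, i) else 0) * Z $$ (a, k))"
    using 1 by (intro sum.cong) auto
  also have "\<dots> = (\<Sum>a\<le>2 * d. - \<eta> * Z $$ (a, i) * Z $$ (a, k))"
    by (intro sum.mono_neutral_cong_right) auto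
  finally show ?thesis
    by (simp add: sum_distrib_left mult.assoc)
qed

text \<open>A state depends on the coefficients only through the predictions at the
  \<open>n + 1\<close> inputs, so \<open>w'\<close> is constrained only there. The values are the
  residuals and the scores the scaled block kernel, whose product is the step of
  \<open>quad_fun_bcd_Suc\<close>.\<close>

lemma attn_state:
  assumes "1 \<le> l" "l \<le> d"
    and w': "\<And>k. k \<le> n \<Longrightarrow> quad_fun d w' (xvec d \<omega> k) = quad_fun d w (xvec d \<omega> k) - \<eta> / real n *
      (\<Sum>i<n. (quad_fun d w (xvec d \<omega> i) + label d \<omega> i) *
        (\<Sum>j\<in>block d l. feature j (xvec d \<omega> i) * feature j (xvec d \<omega> k)))"
  shows "attn n (attn_value d) (attn_key_query d \<eta>) (state d n \<omega> l w) = state d n \<omega> l w'"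
proof (rule eq_matI)
  let ?Z = "state d n \<omega> l w"
  have c: "attn_value d \<in> carrier_mat (2 * d + 2) (2 * d + 2)"
    "attn_key_query d \<eta> \<in> carrier_mat (2 * d + 2) (2 * d + 2)"
    "?Z \<in> carrier_mat (2 * d + 2) (n + 1)"
    by (auto simp: attn_value_def attn_key_query_def state_def)
  show "dim_row (attn n (attn_value d) (attn_key_query d \<eta>) ?Z) = dim_row (state d n \<omega> l w')"
    "dim_col (attn n (attn_value d) (attn_key_query d \<eta>) ?Z) = dim_col (state d n \<omega> l w')"
    unfolding attn_dims[OF c(1,3)] by (simp_all add: state_def)
  fix r k assume "r < dim_row (state d n \<omega> l w')" "k < dim_col (state d n \<omega> l w')"
  then have r: "r < 2 * d + 2" and k: "k \<le> n"
    by (auto simp: state_def)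
  have form: "(transpose_mat ?Z * attn_key_query d \<eta> * ?Z) $$ (i, k) =
      - \<eta> * (\<Sum>j\<in>block d l. feature j (xvec d \<omega> i) * feature j (xvec d \<omega> k))" if "i < n" for i
  proof -
    \<comment> \<open>Injectivity of \<open>row_feature\<close> turns the sum over rows into one
      over monomials.\<close>
    have "(\<Sum>a\<le>2 * d. ?Z $$ (a, i) * ?Z $$ (a, k)) =
        (\<Sum>j\<in>row_feature d l ` {..2 * d}. feature j (xvec d \<omega> i) * feature j (xvec d \<omega> k))"
      using assms(1) that k
      by (subst sum.reindex[OF inj_on_row_feature]) (auto simp: state_feature intro!: sum.cong)
    then show ?thesis
      using attn_key_query_form[OF c(3), of i k \<eta>] that k assms(1,2) by (simp add: block_def)
  qed
  have "attn n (attn_value d) (attn_key_query d \<eta>) ?Z $$ (r, k) = ?Z $$ (r, k) +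
      1 / real n * (\<Sum>i<n. (if r = 2 * d + 1 then ?Z $$ (r, i) else 0) *
        (- \<eta> * (\<Sum>j\<in>block d l. feature j (xvec d \<omega> i) * feature j (xvec d \<omega> k))))"
    unfolding attn_index[OF c r k]
    using attn_value_mult_index[OF c(3) r] form by (auto intro!: sum.cong)
  also have "\<dots> = state d n \<omega> l w' $$ (r, k)"
  proof (cases "r = 2 * d + 1")
    case True
    have "(\<Sum>i<n. ?Z $$ (r, i) *
        (- \<eta> * (\<Sum>j\<in>block d l. feature j (xvec d \<omega> i) * feature j (xvec d \<omega> k)))) =
        - \<eta> * (\<Sum>i<n. (quad_fun d w (xvec d \<omega> i) + label d \<omega> i) *
        (\<Sum>j\<in>block d l. feature j (xvec d \<omega> i) * feature j (xvec d \<omega> k)))"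
      unfolding sum_distrib_left[where r = "- \<eta>" and A = "{..<n}"]
      using True by (intro sum.cong) (simp_all add: state_last)
    then show ?thesis
      using True k w'[OF k] by (simp add: state_last)
  next
    case False
    then show ?thesis
      using r k by (simp add: state_def)
  qed
  finally show "attn n (attn_value d) (attn_key_query d \<eta>) ?Z $$ (r, k) =
    state d n \<omega> l w' $$ (r, k)" .
qed

section \<open>The run of all layers on the prompt\<close>

lemma prompt_eq_state: "prompt d (Suc (2 * d)) n \<omega> = state d n \<omega> 0 (0\<^sub>v (nfeat d))"
  \<comment> \<open>Zero coefficients predict 0, which leaves the labels in the context columns and
    0 in the query column.\<close>
  by (rule eq_matI) (auto simp: prompt_def state_def quad_fun_eq_sum vec_index_vCons)

lemma transformer_state:
  fixes d :: nat and eta :: "nat \<Rightarrow> real"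
  defines "T \<equiv> \<lambda>n \<omega>. transformer n (bilin_left d) (\<lambda>_. bilin_right d) (\<lambda>_. attn_value d)
    (\<lambda>l. attn_key_query d (eta (Suc l))) (prompt d (Suc (2 * d)) n \<omega>)"
    and "w \<equiv> \<lambda>n \<omega>. bcd (nfeat d) (loss d n \<omega>) eta (block d)"
  shows "l \<le> d \<Longrightarrow> T n \<omega> (2 * l) = state d n \<omega> l (w n \<omega> l)"
    and "l < d \<Longrightarrow> T n \<omega> (2 * l + 1) = state d n \<omega> (Suc l) (w n \<omega> l)"
proof -
  \<comment> \<open>Stated for a single round first, because the induction over rounds passes
    through the output between its two layers.\<close>
  have half: "T n \<omega> (2 * l + 1) = state d n \<omega> (Suc l) (w n \<omega> l)"
    if "l < d" "T n \<omega> (2 * l) = state d n \<omega> l (w n \<omega> l)" for l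
    using that by (simp add: T_def bilin_state)
  have even: "l \<le> d \<Longrightarrow> T n \<omega> (2 * l) = state d n \<omega> l (w n \<omega> l)" for l
  proof (induction l)
    case 0
    then show ?case by (simp add: T_def w_def prompt_eq_state)
  next
    case (Suc l)
    have "T n \<omega> (2 * Suc l) =
        attn n (attn_value d) (attn_key_query d (eta (Suc l))) (T n \<omega> (2 * l + 1))"
      by (simp add: T_def)
    also have "T n \<omega> (2 * l + 1) = state d n \<omega> (Suc l) (w n \<omega> l)"
      using Suc by (intro half) auto
    also have "attn n (attn_value d) (attn_key_query d (eta (Suc l))) \<dots> =
        state d n \<omega> (Suc l) (w n \<omega> (Suc l))"
      unfolding w_def using Suc.prems
      by (intro attn_state quad_fun_bcd_Suc block_subset) auto
    finally show ?case .
  qed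
  show "l \<le> d \<Longrightarrow> T n \<omega> (2 * l) = state d n \<omega> l (w n \<omega> l)"
    by (rule even)
  show "l < d \<Longrightarrow> T n \<omega> (2 * l + 1) = state d n \<omega> (Suc l) (w n \<omega> l)"
    by (intro half even) auto
qed

section \<open>The monomials contained in the columns\<close>

definition unlabelled_outcome :: "nat \<Rightarrow> nat \<Rightarrow> real vec \<Rightarrow> outcome" where
  "unlabelled_outcome d n x =
     (\<lambda>(k, j)\<in>{..n} \<times> {..<d}. x $ j, \<lambda>_\<in>{(i, j). i \<le> j \<and> j \<le> d}. 0)"

text \<open>The bounded abstractions make both components extensional, as points of a product space
  must be.\<close>

lemma unlabelled_outcome_space: "unlabelled_outcome d n x \<in> space (icl_problem d n)"
  by (auto simp: unlabelled_outcome_def icl_problem_def space_pair_measure space_PiM)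

lemma xvec_unlabelled_outcome:
  "x \<in> carrier_vec d \<Longrightarrow> k \<le> n \<Longrightarrow> xvec d (unlabelled_outcome d n x) k = x"
  by (auto simp: xvec_def unlabelled_outcome_def)

lemma label_unlabelled_outcome: "label d (unlabelled_outcome d n x) k = 0"
  by (simp add: label_def target_def unlabelled_outcome_def)

text \<open>Outcomes with zero target put any chosen \<open>x\<close> into a column. This identifies
  the monomial of each row up to \<open>2 * d\<close>, and it rules out the last row, which is then
  0 while every monomial equals 1 at the all-ones vector.\<close>

lemma column_features_eq_block:
  fixes eta :: "nat \<Rightarrow> real"
  assumes "1 \<le> l" "l \<le> d"
  shows "column_features d (Suc (2 * d)) (bilin_left d) (\<lambda>_. bilin_right d) (\<lambda>_. attn_value d)
    (\<lambda>l. attn_key_query d (eta (Suc l))) (2 * l - 1) = block d l"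
proof -
  \<comment> \<open>Output \<open>2 * l - 1\<close> precedes the attention layer of round
    \<open>l\<close>, so the predictions are still those of iterate \<open>l - 1\<close>.\<close>
  define w where "w n \<omega> = bcd (nfeat d) (loss d n \<omega>) eta (block d) (l - 1)" for n \<omega>
  have T: "transformer n (bilin_left d) (\<lambda>_. bilin_right d) (\<lambda>_. attn_value d)
    (\<lambda>l. attn_key_query d (eta (Suc l))) (prompt d (Suc (2 * d)) n \<omega>) (2 * l - 1) =
      state d n \<omega> l (w n \<omega>)" for n \<omega>
    using transformer_state(2)[of "l - 1" d n eta \<omega>] assms by (cases l) (auto simp: w_def)
  have carried: "j \<in> block d l"
    if j: "j < nfeat d" and r: "r \<le> 2 * d + 1"
      and eq: "\<And>n \<omega> k. n \<ge> 1 \<Longrightarrow> \<omega> \<in> space (icl_problem d n) \<Longrightarrow> k \<le> n \<Longrightarrow>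
        state d n \<omega> l (w n \<omega>) $$ (r, k) = feature j (xvec d \<omega> k)" for j r
  proof -
    \<comment> \<open>Context length 1 suffices; column 1 is then the query column.\<close>
    have eq': "state d 1 (unlabelled_outcome d 1 x) l (w 1 (unlabelled_outcome d 1 x)) $$ (r, 1) =
        feature j x" if "x \<in> carrier_vec d" for x
      using eq[of 1 "unlabelled_outcome d 1 x" 1] that
      by (simp add: unlabelled_outcome_space xvec_unlabelled_outcome)
    show ?thesis
    proof (cases "r = 2 * d + 1")
      case True
      let ?x = "vec d (\<lambda>_. 1) :: real vec"
      obtain a b where ab: "a \<le> b" "b \<le> d" "j = pair_index a b"
        using j by (rule nfeat_cases)
      have "vCons 1 ?x $ q = 1" if "q \<le> d" for q
        using that by (cases q) auto
      then have "feature j ?x = 1"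
        using ab by (simp add: feature_pair_index)
      moreover have "feature j ?x = 0"
        using eq'[of ?x] True unfolding True
        by (simp add: state_last w_def quad_fun_bcd_zero_labels label_unlabelled_outcome block_subset)
      ultimately show ?thesis by simp
    next
      case False
      then have r': "r \<le> 2 * d" using r by simp
      have "row_feature d l r = j"
      proof (rule feature_eq_imp_eq)
        show "row_feature d l r < nfeat d" "j < nfeat d"
          using row_feature_less[OF assms(2) r'] j by auto
        show "feature (row_feature d l r) x = feature j x" if "x \<in> carrier_vec d" for x
          using eq'[OF that] r' assms(1) that by (simp add: state_feature xvec_unlabelled_outcome)
      qed
      then show ?thesis
        using r' assms by (auto simp: block_def)
    qed
  qed
  show ?thesis
    unfolding column_features_def T
  proof (intro equalityI subsetI)
    fix j assume "j \<in> block d l"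
    then obtain r where "r \<le> 2 * d" "j = row_feature d l r"
      using assms by (auto simp: block_def)
    then show "j \<in> {j. j < nfeat d \<and> (\<exists>r\<le>Suc (2 * d). \<forall>n\<ge>1. \<forall>\<omega>\<in>space (icl_problem d n). \<forall>k\<le>n.
        state d n \<omega> l (w n \<omega>) $$ (r, k) = feature j (xvec d \<omega> k))}"
      using assms by (auto simp: state_feature row_feature_less intro!: exI[of _ r])
  qed (use carried in auto)
qed

section \<open>Choice of depth, weights and blocks\<close>

theorem theorem7:
  fixes d D :: nat and eta :: "nat \<Rightarrow> real"
  assumes "d \<ge> 1" and "D = 2 * d + 1"
  shows "\<exists>(L::nat) W0 W1 P Q b.
    (\<forall>l<L. W0 l \<in> carrier_mat D D \<and> W1 l \<in> carrier_mat D D \<and>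
           P l \<in> carrier_mat (D + 1) (D + 1) \<and> Q l \<in> carrier_mat (D + 1) (D + 1)) \<and>
    (\<Union>l\<in>{1..L}. b l) = {..<nfeat d} \<and>
    (\<forall>l\<in>{1..L}. b l = column_features d D W0 W1 P Q (2 * l - 1)) \<and>
    (\<forall>n\<ge>1. \<forall>\<omega>\<in>space (icl_problem d n). \<forall>l\<le>L.
       transformer n W0 W1 P Q (prompt d D n \<omega>) (2 * l) $$ (D, n) =
       vCons 1 (xvec d \<omega> n) \<bullet>
         (smat d (bcd (nfeat d) (loss d n \<omega>) eta b l) *\<^sub>v vCons 1 (xvec d \<omega> n)))"
proof (intro exI conjI)
  have D: "D = Suc (2 * d)"
    using assms(2) by simp
  \<comment> \<open>One round per input coordinate, so the depth is \<open>d\<close>. The weights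
    depend only on \<open>d\<close> and \<open>eta\<close>, hence serve all context lengths and
    outcomes; weight \<open>l\<close> belongs to iterate \<open>Suc l\<close> and takes its step
    size.\<close>
  let ?W0 = "bilin_left d" and ?W1 = "\<lambda>_::nat. bilin_right d" and ?P = "\<lambda>_::nat. attn_value d"
    and ?Q = "\<lambda>l. attn_key_query d (eta (Suc l))"
  show "\<forall>l<d. ?W0 l \<in> carrier_mat D D \<and> ?W1 l \<in> carrier_mat D D \<and>
      ?P l \<in> carrier_mat (D + 1) (D + 1) \<and> ?Q l \<in> carrier_mat (D + 1) (D + 1)"
    by (simp add: D bilin_left_def bilin_right_def attn_value_def attn_key_query_def add_2_eq_Suc')
  show "(\<Union>l\<in>{1..d}. block d l) = {..<nfeat d}"
    using assms(1) by (rule Union_block)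
  show "\<forall>l\<in>{1..d}. block d l = column_features d D ?W0 ?W1 ?P ?Q (2 * l - 1)"
    unfolding D using column_features_eq_block by auto
  show "\<forall>n\<ge>1. \<forall>\<omega>\<in>space (icl_problem d n). \<forall>l\<le>d.
       transformer n ?W0 ?W1 ?P ?Q (prompt d D n \<omega>) (2 * l) $$ (D, n) =
       vCons 1 (xvec d \<omega> n) \<bullet>
         (smat d (bcd (nfeat d) (loss d n \<omega>) eta (block d) l) *\<^sub>v vCons 1 (xvec d \<omega> n))"
    unfolding D by (simp add: transformer_state(1) state_last quad_fun_def)
qed

end
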